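(* Let $G$ be a one-step $W$-groupoid and let $e,f\in G$ with $e\neq f$, $ef\neq fe$ and $G=\langle e,f\rangle$. If $\|e\|=2$, then $G$ is isomorphic to the quasigroup with four elements $e,f,ef,fe$ and the following Cayley table (the entry in row $x$ and column $y$ is the product $xy$): $$\begin{array}{c|cccc} & e & f & ef & fe\\ \hline e & e & ef & fe & f\\ f & fe & f & e & ef\\ ef & f & fe & ef & e\\ fe & ef & e & f & fe \end{array}$$
   Context: A groupoid is a set with a binary operation, written by juxtaposition. $W$ is the variety of idempotent right modular groupoids, i.e. groupoids satisfying $xx=x$ and $(xy)z=(zy)x$ for all $x,y,z$. A one-step $W$-groupoid is a non-commutative groupoid $G\in W$ (finite or infinite) such that every proper subgroupoid of $G$ is commutative. $\langle x,y\rangle$ denotes the subgroupoid generated by $x$ and $y$. In the situation of the claim, put $g=ef$; then it is known that $G=\langle f,g\rangle$. A word is a finite product of terms, each equal to $f$ or to $g=ef$, bracketed in any meaningful manner; its length is the number of such terms (counted with repetition, each occurrence of $f$ or of $ef$ counting as one term). For $x\in G$, $\|x\|$ denotes the minimum length of a word representing $x$. The number $\|e\|$ is called the dimension of $G$. *)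

theory Defs
  imports Main "HOL-Library.Extended_Nat"
begin

definition groupoid :: "'a set \<Rightarrow> ('a \<Rightarrow> 'a \<Rightarrow> 'a) \<Rightarrow> bool" where
  "groupoid G m \<longleftrightarrow> (\<forall>x\<in>G. \<forall>y\<in>G. m x y \<in> G)"

definition W_groupoid :: "'a set \<Rightarrow> ('a \<Rightarrow> 'a \<Rightarrow> 'a) \<Rightarrow> bool" where
  "W_groupoid G m \<longleftrightarrow> groupoid G m \<and>
     (\<forall>x\<in>G. m x x = x) \<and>
     (\<forall>x\<in>G. \<forall>y\<in>G. \<forall>z\<in>G. m (m x y) z = m (m z y) x)"

definition subgroupoid :: "'a set \<Rightarrow> 'a set \<Rightarrow> ('a \<Rightarrow> 'a \<Rightarrow> 'a) \<Rightarrow> bool" where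
  "subgroupoid H G m \<longleftrightarrow> H \<subseteq> G \<and> groupoid H m"

definition commutative_on :: "'a set \<Rightarrow> ('a \<Rightarrow> 'a \<Rightarrow> 'a) \<Rightarrow> bool" where
  "commutative_on H m \<longleftrightarrow> (\<forall>x\<in>H. \<forall>y\<in>H. m x y = m y x)"

definition one_step_W_groupoid :: "'a set \<Rightarrow> ('a \<Rightarrow> 'a \<Rightarrow> 'a) \<Rightarrow> bool" where
  "one_step_W_groupoid G m \<longleftrightarrow> W_groupoid G m \<and> \<not> commutative_on G m \<and>
     (\<forall>H. subgroupoid H G m \<and> H \<noteq> G \<longrightarrow> commutative_on H m)"

definition generated :: "'a set \<Rightarrow> ('a \<Rightarrow> 'a \<Rightarrow> 'a) \<Rightarrow> 'a set \<Rightarrow> 'a set" where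
  "generated G m X = \<Inter>{H. subgroupoid H G m \<and> X \<subseteq> H}"

datatype 'a word = Term 'a | Prod "'a word" "'a word"

primrec word_value :: "('a \<Rightarrow> 'a \<Rightarrow> 'a) \<Rightarrow> 'a word \<Rightarrow> 'a" where
  "word_value m (Term a) = a"
| "word_value m (Prod u v) = m (word_value m u) (word_value m v)"

primrec word_length :: "'a word \<Rightarrow> nat" where
  "word_length (Term a) = 1"
| "word_length (Prod u v) = word_length u + word_length v"

text \<open>The norm of \<open>x\<close>, relative to words in the terms \<open>f\<close> and \<open>ef\<close>; it is infinite
  if no such word represents \<open>x\<close>.\<close>

definition word_norm :: "('a \<Rightarrow> 'a \<Rightarrow> 'a) \<Rightarrow> 'a \<Rightarrow> 'a \<Rightarrow> 'a \<Rightarrow> enat" where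
  "word_norm m e f x =
     (INF w \<in> {w. set_word w \<subseteq> {f, m e f} \<and> word_value m w = x}. enat (word_length w))"

definition groupoid_iso ::
  "('a \<Rightarrow> 'b) \<Rightarrow> 'a set \<Rightarrow> ('a \<Rightarrow> 'a \<Rightarrow> 'a) \<Rightarrow> 'b set \<Rightarrow> ('b \<Rightarrow> 'b \<Rightarrow> 'b) \<Rightarrow> bool" where
  "groupoid_iso h G m G' m' \<longleftrightarrow> bij_betw h G G' \<and>
     (\<forall>x\<in>G. \<forall>y\<in>G. h (m x y) = m' (h x) (h y))"

datatype quad = Qe | Qf | Qef | Qfe

fun quad_mult :: "quad \<Rightarrow> quad \<Rightarrow> quad" where
  "quad_mult Qe  Qe = Qe"  | "quad_mult Qe  Qf = Qef" | "quad_mult Qe  Qef = Qfe" | "quad_mult Qe  Qfe = Qf"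
| "quad_mult Qf  Qe = Qfe" | "quad_mult Qf  Qf = Qf"  | "quad_mult Qf  Qef = Qe"  | "quad_mult Qf  Qfe = Qef"
| "quad_mult Qef Qe = Qf"  | "quad_mult Qef Qf = Qfe" | "quad_mult Qef Qef = Qef" | "quad_mult Qef Qfe = Qe"
| "quad_mult Qfe Qe = Qef" | "quad_mult Qfe Qf = Qe"  | "quad_mult Qfe Qef = Qf"  | "quad_mult Qfe Qfe = Qfe"

lemma quad_quasigroup: "(\<exists>!x. quad_mult a x = b) \<and> (\<exists>!y. quad_mult y a = b)"
proof -
  have all: "(\<forall>x. P x) \<longleftrightarrow> P Qe \<and> P Qf \<and> P Qef \<and> P Qfe" for P
    by (metis quad.exhaust)
  have ex: "(\<exists>x. P x) \<longleftrightarrow> P Qe \<or> P Qf \<or> P Qef \<or> P Qfe" for P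
    by (metis quad.exhaust)
  show ?thesis
    unfolding Ex1_def ex all by (cases a; cases b; simp)
qed

end

theory Submission
  imports Defs
begin

text \<open>As \<open>e\<close> has norm two, it is one of \<open>ff\<close>, \<open>f(ef)\<close>, \<open>(ef)f = fe\<close> and \<open>(ef)(ef)\<close>. In a one-step
  \<open>W\<close>-groupoid \<open>yx = x\<close> forces \<open>xy = x\<close>, since otherwise \<open>{x, xy}\<close> would be a proper
  non-commutative subgroupoid; hence \<open>e = f(ef)\<close>.
  Put \<open>k = (ef)e\<close>. Then \<open>ek = ef\<close>, so that \<open>k(ek) = e\<close> and \<open>(ek)e = k\<close>, and in \<open>W\<close> these two
  relations make \<open>e, k, ek, ke\<close> the image of the four-element quasigroup under a homomorphism.
  It is injective because the quasigroup is simple, and onto because the image is not commutative.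
  Finally \<open>f(ef) = e = k(ef)\<close>, so \<open>f = k\<close> by cancellation in the quasigroup.\<close>

lemma word_length_pos: "0 < word_length w"
  by (induction w) auto

lemma word_length_eq_1_iff: "word_length w = 1 \<longleftrightarrow> (\<exists>a. w = Term a)"
proof (cases w)
  case (Prod u v)
  then show ?thesis
    using word_length_pos[of u] word_length_pos[of v] by auto
qed auto

lemma word_length_eq_2_iff: "word_length w = 2 \<longleftrightarrow> (\<exists>a b. w = Prod (Term a) (Term b))"
proof (cases w)
  case (Prod u v)
  have "word_length u + word_length v = 2 \<longleftrightarrow> word_length u = 1 \<and> word_length v = 1"
    using word_length_pos[of u] word_length_pos[of v] by arith
  then show ?thesis
    using Prod by (auto simp: word_length_eq_1_iff[unfolded One_nat_def])
qed auto

lemma word_norm_eq_enatE: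
  assumes "word_norm m e f x = enat n"
  obtains w where "set_word w \<subseteq> {f, m e f}" "word_value m w = x" "word_length w = n"
proof -
  let ?L = "(\<lambda>w. enat (word_length w)) ` {w. set_word w \<subseteq> {f, m e f} \<and> word_value m w = x}"
  have Inf_L: "Inf ?L = enat n"
    using assms by (simp add: word_norm_def)
  then have "?L \<noteq> {}"
    by (auto simp: Inf_enat_def split: if_splits)
  then obtain l where "l \<in> ?L"
    by blast
  then have "Inf ?L \<in> ?L"
    by (rule wellorder_InfI)
  then show ?thesis
    using that unfolding Inf_L by auto
qed

lemma word_norm_eq_2_imp_product:
  assumes "word_norm m e f x = 2"
  shows "x \<in> {m f f, m f (m e f), m (m e f) f, m (m e f) (m e f)}"
proof -
  have "word_norm m e f x = enat 2"
    using assms by (simp add: numeral_eq_enat)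
  then obtain w where w: "set_word w \<subseteq> {f, m e f}" "word_value m w = x" "word_length w = 2"
    by (rule word_norm_eq_enatE)
  from w(3) obtain a b where "w = Prod (Term a) (Term b)"
    by (auto simp: word_length_eq_2_iff)
  with w(1,2) show ?thesis
    by auto
qed

lemma groupoid_iso_inv_into:
  assumes iso: "groupoid_iso h G m G' m'" and "groupoid G m"
  shows "groupoid_iso (inv_into G h) G' m' G m"
proof -
  have bij: "bij_betw h G G'"
    and hom: "\<And>x y. x \<in> G \<Longrightarrow> y \<in> G \<Longrightarrow> h (m x y) = m' (h x) (h y)"
    using iso by (auto simp: groupoid_iso_def)
  have inv: "inv_into G h u \<in> G" "h (inv_into G h u) = u" if "u \<in> G'" for u
    using bij that by (auto simp: bij_betw_def inv_into_into f_inv_into_f)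
  have "inv_into G h (m' u v) = m (inv_into G h u) (inv_into G h v)" if "u \<in> G'" "v \<in> G'" for u v
  proof (rule inv_into_f_eq)
    show "inj_on h G"
      using bij by (rule bij_betw_imp_inj_on)
    show "m (inv_into G h u) (inv_into G h v) \<in> G"
      using \<open>groupoid G m\<close> inv(1) that by (simp add: groupoid_def)
    show "h (m (inv_into G h u) (inv_into G h v)) = m' u v"
      using that by (simp add: hom inv)
  qed
  then show ?thesis
    using bij_betw_inv_into[OF bij] by (simp add: groupoid_iso_def)
qed

lemma quad_mult_idem: "quad_mult p p = p"
  by (cases p) simp_all

lemma quad_pair_generates:
  assumes "p \<noteq> q"
  shows "r \<in> {p, q, quad_mult p q, quad_mult q p}"
  using assms by (cases p; cases q; cases r) simp_all

lemma quad_mult_right_cancel: "quad_mult p r = quad_mult q r \<longleftrightarrow> p = q"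
  using quad_quasigroup by metis

lemma quad_hom_inj:
  assumes hom: "\<And>p q. \<phi> (quad_mult p q) = m (\<phi> p) (\<phi> q)"
    and "\<phi> r \<noteq> \<phi> s"
  shows "inj \<phi>"
proof (rule injI, rule ccontr)
  fix p q
  assume eq: "\<phi> p = \<phi> q" and "p \<noteq> q"
  have "m (\<phi> p) (\<phi> p) = \<phi> p"
    using hom[of p p] by (simp add: quad_mult_idem)
  then have "\<phi> t = \<phi> p" for t
    using quad_pair_generates[OF \<open>p \<noteq> q\<close>, of t] eq by (auto simp: hom)
  then show False
    using \<open>\<phi> r \<noteq> \<phi> s\<close> by metis
qed

primrec quad_eval :: "('a \<Rightarrow> 'a \<Rightarrow> 'a) \<Rightarrow> 'a \<Rightarrow> 'a \<Rightarrow> quad \<Rightarrow> 'a" where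
  "quad_eval m x y Qe = x"
| "quad_eval m x y Qf = y"
| "quad_eval m x y Qef = m x y"
| "quad_eval m x y Qfe = m y x"

definition quad_relations :: "('a \<Rightarrow> 'a \<Rightarrow> 'a) \<Rightarrow> 'a \<Rightarrow> 'a \<Rightarrow> bool" where
  "quad_relations m x y \<longleftrightarrow> m y (m x y) = x \<and> m (m x y) x = y"

locale W_groupoid_on =
  fixes G :: "'a set" and m :: "'a \<Rightarrow> 'a \<Rightarrow> 'a" (infixl \<open>\<cdot>\<close> 70)
  assumes W: "W_groupoid G m"
begin

lemma groupoid: "groupoid G m"
  using W by (simp add: W_groupoid_def)

lemma closed [simp]: "x \<in> G \<Longrightarrow> y \<in> G \<Longrightarrow> x \<cdot> y \<in> G"
  using groupoid by (simp add: groupoid_def)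

lemma idem [simp]: "x \<in> G \<Longrightarrow> x \<cdot> x = x"
  using W by (simp add: W_groupoid_def)

lemma right_modular: "x \<in> G \<Longrightarrow> y \<in> G \<Longrightarrow> z \<in> G \<Longrightarrow> x \<cdot> y \<cdot> z = z \<cdot> y \<cdot> x"
  using W by (simp add: W_groupoid_def)

lemma mult_mult_same: "x \<in> G \<Longrightarrow> y \<in> G \<Longrightarrow> x \<cdot> y \<cdot> y = y \<cdot> x"
  by (simp add: right_modular[of x y y])

lemma medial:
  assumes "x \<in> G" "y \<in> G" "z \<in> G" "w \<in> G"
  shows "(x \<cdot> y) \<cdot> (z \<cdot> w) = (x \<cdot> z) \<cdot> (y \<cdot> w)"
  using assms right_modular[of x y "z \<cdot> w"] right_modular[of z w y] right_modular[of "y \<cdot> w" z x]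
  by simp

lemma elastic: "x \<in> G \<Longrightarrow> y \<in> G \<Longrightarrow> x \<cdot> (y \<cdot> x) = x \<cdot> y \<cdot> x"
  using medial[of x x y x] by simp

lemma left_fixed_imp_right_zero_pair:
  assumes "x \<in> G" "y \<in> G" and "y \<cdot> x = x"
  shows "x \<cdot> y \<cdot> x = x" and "x \<cdot> (x \<cdot> y) = x \<cdot> y"
proof -
  show xyx: "x \<cdot> y \<cdot> x = x"
    using assms elastic[of x y] by simp
  show "x \<cdot> (x \<cdot> y) = x \<cdot> y"
    using assms right_modular[of y x "x \<cdot> y"] xyx by simp
qed

lemma quad_eval_hom:
  assumes [simp]: "x \<in> G" "y \<in> G" and relations: "quad_relations m x y"
  shows "quad_eval m x y (quad_mult p q) = quad_eval m x y p \<cdot> quad_eval m x y q"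
proof -
  define g h where "g = x \<cdot> y" and "h = y \<cdot> x"
  have [simp]: "g \<in> G" "h \<in> G" and xy: "x \<cdot> y = g" and yx: "y \<cdot> x = h"
    by (simp_all add: g_def h_def)
  have yg: "y \<cdot> g = x" and gx: "g \<cdot> x = y"
    using relations by (simp_all add: quad_relations_def xy)
  have gy: "g \<cdot> y = h"
    using mult_mult_same[of x y] by (simp add: xy yx)
  have hx: "h \<cdot> x = g"
    using mult_mult_same[of y x] by (simp add: xy yx)
  have xg: "x \<cdot> g = h"
    using mult_mult_same[of y g] by (simp add: yg gy)
  have hy: "h \<cdot> y = x"
    using elastic[of y x] by (simp add: xy yx yg)
  have hg: "h \<cdot> g = y"
    using elastic[of g y] by (simp add: gy yg gx)
  have gh: "g \<cdot> h = x"
    using right_modular[of x y h] by (simp add: xy hy)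
  have xh: "x \<cdot> h = y"
    using elastic[of x y] by (simp add: xy yx gx)
  have yh: "y \<cdot> h = g"
    using right_modular[of g x h] by (simp add: gx hx)
  show ?thesis
    by (cases p; cases q) (simp_all add: xy yx yg gx gy hx xg hy hg gh xh yh)
qed

lemma quad_relations_conjugate:
  assumes [simp]: "x \<in> G" "y \<in> G" and yxy: "y \<cdot> (x \<cdot> y) = x"
  shows "x \<cdot> (x \<cdot> y \<cdot> x) = x \<cdot> y"
    and "x \<cdot> y \<cdot> x \<cdot> x = y \<cdot> x"
    and "quad_relations m x (x \<cdot> y \<cdot> x)"
proof -
  have xg: "x \<cdot> (x \<cdot> y) = y \<cdot> x"
    using mult_mult_same[of y "x \<cdot> y"] mult_mult_same[of x y] by (simp add: yxy)
  show xk: "x \<cdot> (x \<cdot> y \<cdot> x) = x \<cdot> y"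
    using elastic[of x "x \<cdot> y"] mult_mult_same[of y x] by (simp add: xg)
  show "x \<cdot> y \<cdot> x \<cdot> x = y \<cdot> x"
    using mult_mult_same[of "x \<cdot> y" x] by (simp add: xg)
  have "y \<cdot> x \<cdot> y = x"
    using elastic[of y x] by (simp add: yxy)
  then have "x \<cdot> y \<cdot> (y \<cdot> x) = x"
    using right_modular[of x y "y \<cdot> x"] by simp
  then have "x \<cdot> y \<cdot> x \<cdot> (x \<cdot> y) = x"
    using elastic[of "x \<cdot> y" x] by (simp add: xg)
  then show "quad_relations m x (x \<cdot> y \<cdot> x)"
    by (simp add: quad_relations_def xk)
qed

end

locale one_step_W_groupoid_on =
  fixes G :: "'a set" and m :: "'a \<Rightarrow> 'a \<Rightarrow> 'a" (infixl \<open>\<cdot>\<close> 70)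
  assumes one_step: "one_step_W_groupoid G m"

sublocale one_step_W_groupoid_on \<subseteq> W_groupoid_on
  using one_step by unfold_locales (simp add: one_step_W_groupoid_def)

context one_step_W_groupoid_on
begin

lemma noncommutative_subgroupoid_eq:
  assumes "H \<subseteq> G" "groupoid H m" "x \<in> H" "y \<in> H" "x \<cdot> y \<noteq> y \<cdot> x"
  shows "H = G"
  using assms one_step
  unfolding one_step_W_groupoid_def subgroupoid_def commutative_on_def by metis

lemma left_fixed_imp_right_fixed:
  assumes [simp]: "x \<in> G" "y \<in> G" and yx: "y \<cdot> x = x"
  shows "x \<cdot> y = x"
proof (rule ccontr)
  assume ne: "x \<cdot> y \<noteq> x"
  note products = left_fixed_imp_right_zero_pair[OF assms]
  have "groupoid {x, x \<cdot> y} m"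
    by (simp add: groupoid_def products)
  then have "{x, x \<cdot> y} = G"
    by (rule noncommutative_subgroupoid_eq[where x = x and y = "x \<cdot> y", rotated])
      (use ne products in auto)
  with \<open>y \<in> G\<close> have "y \<in> {x, x \<cdot> y}"
    by (simp only:)
  then consider (eq) "y = x" | (right_fixed) "x \<cdot> y = y"
    by (metis insertE singletonD)
  then show False
  proof cases
    case eq
    with ne show False
      by simp
  next
    case right_fixed
    then have "x \<cdot> y = x"
      using mult_mult_same[of x y] yx by simp
    with ne show False ..
  qed
qed

lemma quad_eval_iso:
  assumes [simp]: "x \<in> G" "y \<in> G" and "quad_relations m x y" and ne: "x \<cdot> y \<noteq> y \<cdot> x"
  shows "groupoid_iso (quad_eval m x y) UNIV quad_mult G m"
proof -
  let ?\<phi> = "quad_eval m x y"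
  have hom: "?\<phi> (quad_mult p q) = ?\<phi> p \<cdot> ?\<phi> q" for p q
    using assms(1-3) by (rule quad_eval_hom)
  have "inj ?\<phi>"
    using hom by (rule quad_hom_inj[where r = Qef and s = Qfe]) (simp add: ne)
  moreover have "range ?\<phi> = G"
  proof (rule noncommutative_subgroupoid_eq)
    have "?\<phi> p \<in> G" for p
      by (cases p) simp_all
    then show "range ?\<phi> \<subseteq> G"
      by blast
    show "groupoid (range ?\<phi>) m"
      by (auto simp: groupoid_def simp flip: hom)
    show "x \<in> range ?\<phi>" "y \<in> range ?\<phi>"
      by (metis quad_eval.simps rangeI)+
  qed (rule ne)
  ultimately show ?thesis
    by (simp add: groupoid_iso_def bij_betw_def hom)
qed

lemma mult_mult_eq_imp_quad_relations:
  assumes [simp]: "x \<in> G" "y \<in> G" and yxy: "y \<cdot> (x \<cdot> y) = x" and ne: "x \<cdot> y \<noteq> y \<cdot> x"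
  shows "quad_relations m x y"
proof -
  define k where "k = x \<cdot> y \<cdot> x"
  have "k \<in> G"
    by (simp add: k_def)
  have xk: "x \<cdot> k = x \<cdot> y" and kx: "k \<cdot> x = y \<cdot> x" and relations: "quad_relations m x k"
    unfolding k_def using assms(1-3) by (rule quad_relations_conjugate)+
  have kxy: "k \<cdot> (x \<cdot> y) = x"
    using relations by (simp add: quad_relations_def xk)
  let ?\<phi> = "quad_eval m x k"
  have "groupoid_iso ?\<phi> UNIV quad_mult G m"
    using assms(1) \<open>k \<in> G\<close> relations by (rule quad_eval_iso) (simp add: xk kx ne)
  then have "inj ?\<phi>" "range ?\<phi> = G" and hom: "?\<phi> (quad_mult p q) = ?\<phi> p \<cdot> ?\<phi> q" for p q
    by (auto simp: groupoid_iso_def bij_betw_def)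
  then obtain p where p: "?\<phi> p = y"
    using \<open>y \<in> G\<close> by (metis rangeE)
  have "?\<phi> (quad_mult p Qef) = ?\<phi> (quad_mult Qf Qef)"
    unfolding hom by (simp add: p xk yxy kxy)
  then have "p = Qf"
    using \<open>inj ?\<phi>\<close> by (simp only: inj_eq quad_mult_right_cancel)
  with p relations show ?thesis
    by simp
qed

lemma mult_mult_eq_of_word_norm_eq_2:
  assumes [simp]: "x \<in> G" "y \<in> G" and "x \<noteq> y" and ne: "x \<cdot> y \<noteq> y \<cdot> x"
    and norm: "word_norm m x y x = 2"
  shows "y \<cdot> (x \<cdot> y) = x"
proof -
  have xyy: "x \<cdot> y \<cdot> y = y \<cdot> x"
    by (simp add: mult_mult_same)
  have "y \<cdot> x \<noteq> x"
    using left_fixed_imp_right_fixed[of x y] ne by auto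
  moreover have "x \<cdot> y \<noteq> x"
    using xyy ne by auto
  moreover have "x \<in> {y, y \<cdot> (x \<cdot> y), y \<cdot> x, x \<cdot> y}"
    using word_norm_eq_2_imp_product[OF norm] by (simp add: xyy)
  ultimately show ?thesis
    using \<open>x \<noteq> y\<close> by simp
qed

end

theorem theorem16:
  fixes G :: "'a set" and m :: "'a \<Rightarrow> 'a \<Rightarrow> 'a" and e f :: 'a
  assumes "one_step_W_groupoid G m"
    and "e \<in> G" and "f \<in> G"
    and "e \<noteq> f"
    and "m e f \<noteq> m f e"
    and "G = generated G m {e, f}"
    and "word_norm m e f e = 2"
  shows "\<exists>h. groupoid_iso h G m UNIV quad_mult \<and>
           h e = Qe \<and> h f = Qf \<and> h (m e f) = Qef \<and> h (m f e) = Qfe"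
proof -
  interpret one_step_W_groupoid_on G m
    using assms(1) by unfold_locales
  let ?\<phi> = "quad_eval m e f"
  have fef: "m f (m e f) = e"
    using assms(2-5,7) by (rule mult_mult_eq_of_word_norm_eq_2)
  have "quad_relations m e f"
    using assms(2,3) fef assms(5) by (rule mult_mult_eq_imp_quad_relations)
  with assms(2,3) have iso: "groupoid_iso ?\<phi> UNIV quad_mult G m"
    using assms(5) by (rule quad_eval_iso)
  then have "groupoid_iso (inv ?\<phi>) G m UNIV quad_mult"
    by (rule groupoid_iso_inv_into) (simp add: groupoid_def)
  moreover have "inv ?\<phi> (?\<phi> p) = p" for p
    using iso by (simp add: groupoid_iso_def bij_betw_def)
  from this[of Qe] this[of Qf] this[of Qef] this[of Qfe]
  have "inv ?\<phi> e = Qe" "inv ?\<phi> f = Qf" "inv ?\<phi> (m e f) = Qef" "inv ?\<phi> (m f e) = Qfe"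
    by simp_all
  ultimately show ?thesis
    by blast
qed

end
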